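(* Let $\mathscr{G}=(\mathscr{V},\mathscr{E})$ be a graph, let $a,k\ge0$, and let $q:\mathscr{V}\to[0,\infty)$ be a potential. (a) $\alpha_{\mathscr{V}}\ge\dfrac1{1+a}$ if and only if $(\mathscr{G},q)$ is $(a,0)$-sparse. (b) If $(\mathscr{G},q)$ is $(a,k)$-sparse, then $$\alpha_{\mathscr{V}}\ge\frac{d-k}{d(1+a)},$$ where $d:=\inf_{x\in\mathscr{V}}(\deg+q)(x)$. In particular, $\alpha_{\mathscr{V}}>0$ if $d>k$. (c) Suppose that $(\mathscr{G},q)$ is $(a,k)$-sparse and is not $(a,k')$-sparse for all $k'<k$ (that is, for no $k'<k$ is it $(a,k')$-sparse). Suppose also that there is $d$ such that $d=\deg(x)+q(x)$ for all $x\in\mathscr{V}$. Then $$\alpha_{\mathscr{V}}=\frac{d-k}{d(1+a)} .$$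
   Context: A graph $\mathscr{G}=(\mathscr{V},\mathscr{E})$ consists of a countable vertex set $\mathscr{V}$ and a symmetric function $\mathscr{E}:\mathscr{V}\times\mathscr{V}\to\{0,1\}$ with zero diagonal; $x\sim y$ means $\mathscr{E}(x,y)=1$. Graphs are locally finite: every vertex has finitely many neighbors; $\deg(x)$ is the number of neighbors of $x$. For finite $\mathscr{W}\subseteq\mathscr{V}$, $g(\mathscr{W}):=\sum_{x\in\mathscr{W}}g(x)$, $|\mathscr{E}_{\mathscr{W}}|:=\frac12|\{(x,y)\in\mathscr{W}\times\mathscr{W}:x\sim y\}|$, and $\partial\mathscr{W}:=\{(x,y)\in\mathscr{W}\times(\mathscr{V}\setminus\mathscr{W}):x\sim y\}$. For $q\ge0$ and given $a\ge0$, $k\ge0$, $(\mathscr{G},q)$ is called $(a,k)$-sparse if $2|\mathscr{E}_{\mathscr{W}}|\le k|\mathscr{W}|+a(|\partial\mathscr{W}|+q(\mathscr{W}))$ for every finite $\mathscr{W}\subseteq\mathscr{V}$. The isoperimetric (Cheeger) constant is $$\alpha_{\mathscr{V}}:=\inf_{\mathscr{W}\subset\mathscr{V}\text{ finite, non-empty}}\frac{|\partial\mathscr{W}|+q(\mathscr{W})}{\deg(\mathscr{W})+q(\mathscr{W})},$$ where by convention the quotient is set equal to $0$ if $\deg(\mathscr{W})+q(\mathscr{W})=0$ (for instance when $\mathscr{W}$ is an isolated point with $q=0$ there).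
   Formalization: In (a), sparse implies the bound only assuming deg(x)+q(x)≠0 for every vertex x, since an isolated vertex with q=0 gives α=0 and makes it false as printed; in (c), k'<k ranges over all reals, negative ones included. *)

theory Defs
  imports "HOL-Library.Extended_Real" "HOL-Library.Countable_Set"
begin

text \<open>Only the restriction of \<open>E\<close> to \<open>V \<times> V\<close> is used; \<open>E x y\<close> stands for \<open>x \<sim> y\<close>.\<close>

locale locally_finite_graph =
  fixes V :: "'a set" and E :: "'a \<Rightarrow> 'a \<Rightarrow> bool"
  assumes countable_verts: "countable V"
    and adj_sym: "x \<in> V \<Longrightarrow> y \<in> V \<Longrightarrow> E x y = E y x"
    and adj_irrefl: "x \<in> V \<Longrightarrow> \<not> E x x"
    and locally_finite: "x \<in> V \<Longrightarrow> finite {y \<in> V. E x y}"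

definition deg :: "'a set \<Rightarrow> ('a \<Rightarrow> 'a \<Rightarrow> bool) \<Rightarrow> 'a \<Rightarrow> real" where
  "deg V E x = real (card {y \<in> V. E x y})"

definition num_edges :: "('a \<Rightarrow> 'a \<Rightarrow> bool) \<Rightarrow> 'a set \<Rightarrow> real" where
  "num_edges E W = 1 / 2 * real (card {(x, y). x \<in> W \<and> y \<in> W \<and> E x y})"

definition edge_boundary :: "'a set \<Rightarrow> ('a \<Rightarrow> 'a \<Rightarrow> bool) \<Rightarrow> 'a set \<Rightarrow> ('a \<times> 'a) set" where
  "edge_boundary V E W = {(x, y). x \<in> W \<and> y \<in> V - W \<and> E x y}"

text \<open>The parameters \<open>a\<close> and \<open>k\<close> are arbitrary reals here; nonnegativity is assumed where needed.
  In particular, the inequality with negative \<open>k\<close> is meaningful, which matters when one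
  speaks of the least \<open>k\<close> for which it holds.\<close>

definition sparse ::
    "'a set \<Rightarrow> ('a \<Rightarrow> 'a \<Rightarrow> bool) \<Rightarrow> ('a \<Rightarrow> real) \<Rightarrow> real \<Rightarrow> real \<Rightarrow> bool" where
  "sparse V E q a k \<longleftrightarrow>
     (\<forall>W. finite W \<and> W \<subseteq> V \<longrightarrow>
        2 * num_edges E W \<le>
          k * real (card W) + a * (real (card (edge_boundary V E W)) + sum q W))"

definition cheeger_quotient ::
    "'a set \<Rightarrow> ('a \<Rightarrow> 'a \<Rightarrow> bool) \<Rightarrow> ('a \<Rightarrow> real) \<Rightarrow> 'a set \<Rightarrow> real" where
  "cheeger_quotient V E q W =
     (if sum (deg V E) W + sum q W = 0 then 0
      else (real (card (edge_boundary V E W)) + sum q W) / (sum (deg V E) W + sum q W))"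

text \<open>Infima are taken in the extended reals, so that they are \<open>\<infinity>\<close> for the empty graph.\<close>

definition cheeger_const ::
    "'a set \<Rightarrow> ('a \<Rightarrow> 'a \<Rightarrow> bool) \<Rightarrow> ('a \<Rightarrow> real) \<Rightarrow> ereal" where
  "cheeger_const V E q =
     (INF W\<in>{W. finite W \<and> W \<noteq> {} \<and> W \<subseteq> V}. ereal (cheeger_quotient V E q W))"

definition inf_deg_pot ::
    "'a set \<Rightarrow> ('a \<Rightarrow> 'a \<Rightarrow> bool) \<Rightarrow> ('a \<Rightarrow> real) \<Rightarrow> ereal" where
  "inf_deg_pot V E q = (INF x\<in>V. ereal (deg V E x + q x))"

end

theory Submission
  imports Defs
begin

text \<open>
  Counting ordered pairs gives \<open>deg(W) = 2|E_W| + |\<partial>W|\<close>. Hence, with \<open>b = |\<partial>W| + q(W)\<close> and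
  \<open>D = (deg + q)(W)\<close>, the sparseness inequality for \<open>W\<close> reads \<open>D \<le> k|W| + (1 + a)b\<close>. For \<open>k = 0\<close>
  this is \<open>b/D \<ge> 1/(1 + a)\<close>, and \<open>D \<ge> d|W|\<close> yields (b). When \<open>D = d|W|\<close> for all \<open>W\<close>, a violation
  of \<open>(a, k')\<close>-sparseness is a set with \<open>b/D < (d - k')/(d(1 + a))\<close>; let \<open>k'\<close> tend to \<open>k\<close>.
\<close>

context locally_finite_graph
begin

text \<open>The ordered adjacent pairs starting in \<open>W\<close> are split by whether they end in
  \<open>W\<close>. Local finiteness makes all these sets finite, so that \<open>card\<close> really
  counts them.\<close>

lemma sum_deg_eq:
  assumes "finite W" "W \<subseteq> V"
  shows "sum (deg V E) W = 2 * num_edges E W + real (card (edge_boundary V E W))"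
proof -
  let ?I = "{(x, y). x \<in> W \<and> y \<in> W \<and> E x y}"
  have eq: "(SIGMA x:W. {y \<in> V. E x y}) = ?I \<union> edge_boundary V E W"
    using assms(2) by (auto simp: edge_boundary_def)
  have fin: "finite (SIGMA x:W. {y \<in> V. E x y})"
    using assms locally_finite by (intro finite_SigmaI) auto
  have "sum (deg V E) W = real (\<Sum>x\<in>W. card {y \<in> V. E x y})"
    by (simp add: deg_def)
  also have "(\<Sum>x\<in>W. card {y \<in> V. E x y}) = card (SIGMA x:W. {y \<in> V. E x y})"
    using assms locally_finite by (subst card_SigmaI) auto
  also have "\<dots> = card ?I + card (edge_boundary V E W)"
    unfolding eq
  proof (rule card_Un_disjoint)
    show "finite ?I" "finite (edge_boundary V E W)"
      using fin unfolding eq by simp_all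
    show "?I \<inter> edge_boundary V E W = {}"
      by (auto simp: edge_boundary_def)
  qed
  finally show ?thesis
    by (simp add: num_edges_def)
qed

text \<open>Adding the boundary term and \<open>q(W)\<close> to both sides turns edges into volume,
  the denominator of the Cheeger quotient.\<close>

lemma sparse_iff:
  "sparse V E q a k \<longleftrightarrow>
     (\<forall>W. finite W \<and> W \<subseteq> V \<longrightarrow>
        sum (deg V E) W + sum q W \<le>
          k * real (card W) + (1 + a) * (real (card (edge_boundary V E W)) + sum q W))"
  unfolding sparse_def by (simp add: sum_deg_eq algebra_simps)

end

locale potential_graph = locally_finite_graph +
  fixes q :: "'a \<Rightarrow> real"
  assumes pot_nonneg: "x \<in> V \<Longrightarrow> q x \<ge> 0"
begin

abbreviation "bnd W \<equiv> real (card (edge_boundary V E W)) + sum q W"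
abbreviation "vol W \<equiv> sum (deg V E) W + sum q W"

lemma bnd_nonneg: "W \<subseteq> V \<Longrightarrow> bnd W \<ge> 0"
  by (intro add_nonneg_nonneg sum_nonneg) (auto intro: pot_nonneg)

lemma vol_nonneg: "W \<subseteq> V \<Longrightarrow> vol W \<ge> 0"
  by (intro add_nonneg_nonneg sum_nonneg) (auto intro: pot_nonneg simp: deg_def)

lemma cheeger_quotient_nonneg: "W \<subseteq> V \<Longrightarrow> cheeger_quotient V E q W \<ge> 0"
  using bnd_nonneg vol_nonneg by (simp add: cheeger_quotient_def)

lemma cheeger_const_nonneg: "cheeger_const V E q \<ge> 0"
  unfolding cheeger_const_def by (intro INF_greatest) (auto intro: cheeger_quotient_nonneg)

lemma cheeger_const_empty: "V = {} \<Longrightarrow> cheeger_const V E q = \<infinity>"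
  by (auto simp: cheeger_const_def top_ereal_def intro!: antisym INF_greatest)

lemma cheeger_const_le:
  "finite W \<Longrightarrow> W \<noteq> {} \<Longrightarrow> W \<subseteq> V \<Longrightarrow> cheeger_const V E q \<le> ereal (cheeger_quotient V E q W)"
  unfolding cheeger_const_def by (intro INF_lower) auto

lemma card_le_vol:
  assumes "\<And>x. x \<in> V \<Longrightarrow> d \<le> deg V E x + q x" "W \<subseteq> V"
  shows "d * real (card W) \<le> vol W"
  using sum_bounded_below[of W d "\<lambda>x. deg V E x + q x"] assms
  by (auto simp: sum.distrib mult.commute)

lemma sparse_if_cheeger_const_ge:
  assumes "a \<ge> 0" "cheeger_const V E q \<ge> ereal (1 / (1 + a))"
  shows "sparse V E q a 0"
  unfolding sparse_iff
proof (intro allI impI, elim conjE)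
  fix W assume W: "finite W" "W \<subseteq> V"
  show "vol W \<le> 0 * real (card W) + (1 + a) * bnd W"
  proof (cases "vol W = 0")
    case True
    \<comment> \<open>A set of volume 0, in particular the empty set, satisfies the inequality
      because the right side is nonnegative.\<close>
    then show ?thesis using bnd_nonneg[OF W(2)] assms(1) by simp
  next
    case False
    then have pos: "vol W > 0" using vol_nonneg[OF W(2)] by linarith
    from False have "W \<noteq> {}" by auto
    then have "ereal (1 / (1 + a)) \<le> ereal (bnd W / vol W)"
      using order_trans[OF assms(2) cheeger_const_le[of W]] W False
      by (simp add: cheeger_quotient_def)
    then show ?thesis
      using pos assms(1) by (simp add: field_simps)
  qed
qed

text \<open>Here \<open>d\<close> is any positive lower bound of \<open>deg + q\<close>, so the
  lemma serves both the infimum in (b) and the constant value in (c).\<close>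

lemma cheeger_const_ge_if_sparse:
  assumes "a \<ge> 0" "k \<ge> 0" "sparse V E q a k" "d > 0"
    and d: "\<And>x. x \<in> V \<Longrightarrow> d \<le> deg V E x + q x"
  shows "cheeger_const V E q \<ge> ereal ((d - k) / (d * (1 + a)))"
  unfolding cheeger_const_def
proof (intro INF_greatest, clarify)
  fix W assume W: "finite W" "W \<noteq> {}" "W \<subseteq> V"
  have n: "real (card W) > 0" using W by (simp add: card_gt_0_iff)
  have dn: "d * real (card W) \<le> vol W" using d W(3) by (rule card_le_vol)
  have pos: "vol W > 0" using dn mult_pos_pos[OF assms(4) n] by linarith
  have sp: "vol W \<le> k * real (card W) + (1 + a) * bnd W"
    using assms(3) W by (auto simp: sparse_iff)
  \<comment> \<open>Scaling by \<open>d\<close> produces \<open>d * card W\<close>, which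
    \<open>k \<ge> 0\<close> allows to be replaced by the volume. The sign of \<open>d - k\<close>
    never matters.\<close>
  have "d * vol W \<le> k * (d * real (card W)) + d * (1 + a) * bnd W"
    using mult_left_mono[OF sp, of d] assms(4) by (simp add: algebra_simps)
  also have "\<dots> \<le> k * vol W + d * (1 + a) * bnd W"
    using mult_left_mono[OF dn assms(2)] by linarith
  finally have "(d - k) * vol W \<le> bnd W * (d * (1 + a))"
    by (simp add: algebra_simps)
  then have "(d - k) / (d * (1 + a)) \<le> bnd W / vol W"
    using pos assms(1,4) by (simp add: divide_simps)
  then show "ereal ((d - k) / (d * (1 + a))) \<le> ereal (cheeger_quotient V E q W)"
    using pos by (simp add: cheeger_quotient_def)
qed

text \<open>Every volume is positive, but the infimum of \<open>deg + q\<close> may be 0, so this is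
  not an instance of the previous bound with \<open>k = 0\<close>.\<close>

lemma cheeger_const_ge_if_sparse_0:
  assumes "a \<ge> 0" "sparse V E q a 0" and nz: "\<And>x. x \<in> V \<Longrightarrow> deg V E x + q x \<noteq> 0"
  shows "cheeger_const V E q \<ge> ereal (1 / (1 + a))"
  unfolding cheeger_const_def
proof (intro INF_greatest, clarify)
  fix W assume W: "finite W" "W \<noteq> {}" "W \<subseteq> V"
  have "(\<Sum>x\<in>W. deg V E x + q x) > 0"
  proof (rule sum_pos[OF W(1,2)])
    fix x assume "x \<in> W"
    then show "deg V E x + q x > 0"
      using nz[of x] pot_nonneg[of x] W(3) by (force simp: deg_def)
  qed
  then have pos: "vol W > 0" by (simp add: sum.distrib)
  have "vol W \<le> (1 + a) * bnd W"
    using assms(2) W by (auto simp: sparse_iff)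
  then have "1 / (1 + a) \<le> bnd W / vol W"
    using pos assms(1) by (simp add: field_simps)
  then show "ereal (1 / (1 + a)) \<le> ereal (cheeger_quotient V E q W)"
    using pos by (simp add: cheeger_quotient_def)
qed

lemma cheeger_const_ge_inf_deg_pot:
  assumes "a \<ge> 0" "k \<ge> 0" "sparse V E q a k"
  shows "cheeger_const V E q \<ge>
           (inf_deg_pot V E q - ereal k) / (inf_deg_pot V E q * ereal (1 + a))"
    and "inf_deg_pot V E q > ereal k \<Longrightarrow> cheeger_const V E q > 0"
proof -
  let ?d = "inf_deg_pot V E q"
  have *: "cheeger_const V E q \<ge> (?d - ereal k) / (?d * ereal (1 + a)) \<and>
           (?d > ereal k \<longrightarrow> cheeger_const V E q > 0)"
  proof (cases "V = {}")
    case True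
    then have "cheeger_const V E q = \<infinity>" by (rule cheeger_const_empty)
    then show ?thesis by (simp only: ereal_less_eq ereal_infty_less) simp
  next
    case False
    then obtain x where x: "x \<in> V" by auto
    have le: "?d \<le> ereal (deg V E y + q y)" if "y \<in> V" for y
      unfolding inf_deg_pot_def using that by (rule INF_lower)
    have ge: "?d \<ge> 0"
      unfolding inf_deg_pot_def by (intro INF_greatest) (auto simp: deg_def pot_nonneg)
    \<comment> \<open>A vertex bounds the infimum from above, so it is a real number.\<close>
    obtain d where d: "?d = ereal d"
      using le[OF x] ge by (cases ?d) auto
    show ?thesis
    proof (cases "d > 0")
      case True
      then have ge': "cheeger_const V E q \<ge> ereal ((d - k) / (d * (1 + a)))"
        using assms le d by (intro cheeger_const_ge_if_sparse) auto
      have "cheeger_const V E q > 0" if "d > k"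
        using True assms(1) that by (intro less_le_trans[OF _ ge']) simp
      moreover have "(?d - ereal k) / (?d * ereal (1 + a)) = ereal ((d - k) / (d * (1 + a)))"
        using True assms(1) d by simp
      ultimately show ?thesis
        using d ge' by simp
    next
      case d0: False
      then have d0: "?d = 0" using ge d by (simp add: zero_ereal_def)
      \<comment> \<open>division by \<open>0\<close> is multiplication by \<open>\<infinity>\<close> in \<open>ereal\<close>, with \<open>0 * \<infinity> = 0\<close>\<close>
      have "(?d - ereal k) / (?d * ereal (1 + a)) \<le> 0"
        using assms(2) unfolding d0 by (cases "k = 0") (auto simp: divide_ereal_def)
      \<comment> \<open>Since \<open>k \<ge> 0\<close>, the premise of the second claim fails for
        infimum 0.\<close>
      from order_trans[OF this cheeger_const_nonneg] show ?thesis
        using d0 assms(2) by simp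
    qed
  qed
  then show "cheeger_const V E q \<ge> (?d - ereal k) / (?d * ereal (1 + a))"
    and "?d > ereal k \<Longrightarrow> cheeger_const V E q > 0" by auto
qed

text \<open>A set violating sparseness is a test set for the infimum. Its volume is exactly
  \<open>d * card W\<close>, so the violation bounds its quotient from above.\<close>

lemma cheeger_const_le_if_not_sparse:
  assumes "a \<ge> 0" "\<not> sparse V E q a k" "d > 0"
    and d: "\<And>x. x \<in> V \<Longrightarrow> deg V E x + q x = d"
  shows "cheeger_const V E q \<le> ereal ((d - k) / (d * (1 + a)))"
proof -
  obtain W where W: "finite W" "W \<subseteq> V"
    and viol: "vol W > k * real (card W) + (1 + a) * bnd W"
    using assms(2) by (auto simp: sparse_iff not_le)
  \<comment> \<open>For the empty set the violation would read \<open>0 > 0\<close>.\<close>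
  have ne: "W \<noteq> {}" using viol by (auto simp: edge_boundary_def)
  then have n: "real (card W) > 0" using W by (simp add: card_gt_0_iff)
  have vol: "vol W = d * real (card W)"
    using W(2) d by (simp add: sum.distrib[symmetric] subset_iff)
  have pos: "vol W > 0" unfolding vol using assms(3) n by simp
  have "(1 + a) * bnd W \<le> (d - k) * real (card W)"
    using viol unfolding vol by (simp add: algebra_simps)
  then have "bnd W / (d * real (card W)) \<le> (d - k) / (d * (1 + a))"
    using assms(1,3) n by (simp add: divide_simps) (simp add: algebra_simps)
  then have "cheeger_quotient V E q W \<le> (d - k) / (d * (1 + a))"
    using pos unfolding cheeger_quotient_def vol by auto
  then show ?thesis
    using cheeger_const_le[OF W(1) ne W(2)] by (meson ereal_less_eq(3) order_trans)
qed

lemma cheeger_const_eq: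
  assumes "a \<ge> 0" "k \<ge> 0" "sparse V E q a k"
    and not_sparse: "\<And>k'. k' < k \<Longrightarrow> \<not> sparse V E q a k'"
    and d: "\<And>x. x \<in> V \<Longrightarrow> d = deg V E x + q x"
  shows "cheeger_const V E q = ereal ((d - k) / (d * (1 + a)))"
proof -
  \<comment> \<open>The empty graph is sparse for every real \<open>k'\<close>, negative ones
    included, so no least \<open>k\<close> exists there.\<close>
  have "V \<noteq> {}"
    using not_sparse[of "k - 1"]
    by (auto simp: sparse_iff edge_boundary_def)
  then obtain x where x: "x \<in> V" by auto
  have "d \<ge> 0" using d[OF x] pot_nonneg[OF x] by (simp add: deg_def)
  show ?thesis
  proof (cases "d = 0")
    \<comment> \<open>Both sides are 0: the right one because real division by 0 gives 0, the left
      one by the convention for a singleton of volume 0.\<close>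
    case True
    then have "cheeger_quotient V E q {x} = 0"
      using d[OF x] by (simp add: cheeger_quotient_def)
    then have "cheeger_const V E q \<le> 0"
      using cheeger_const_le[of "{x}"] x by (simp add: zero_ereal_def)
    then show ?thesis
      using True cheeger_const_nonneg by (simp add: zero_ereal_def antisym)
  next
    case False
    with \<open>d \<ge> 0\<close> have dpos: "d > 0" by simp
    show ?thesis
    proof (rule antisym)
      show "cheeger_const V E q \<ge> ereal ((d - k) / (d * (1 + a)))"
        using assms dpos by (intro cheeger_const_ge_if_sparse) auto
      show "cheeger_const V E q \<le> ereal ((d - k) / (d * (1 + a)))"
      proof (rule ereal_le_epsilon2)
        fix e :: real assume e: "e > 0"
        \<comment> \<open>Lowering \<open>k\<close> by this amount raises the upper bound by exactly
          \<open>e\<close>.\<close>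
        let ?k' = "k - e * (d * (1 + a))"
        have c: "d * (1 + a) > 0" using dpos assms(1) by simp
        then have "?k' < k" using e by simp
        then have "cheeger_const V E q \<le> ereal ((d - ?k') / (d * (1 + a)))"
          using assms(1) not_sparse dpos d[symmetric]
          by (intro cheeger_const_le_if_not_sparse) auto
        also have "(d - ?k') / (d * (1 + a)) = (d - k) / (d * (1 + a)) + e"
          using c by (simp add: field_simps)
        finally show "cheeger_const V E q \<le> ereal ((d - k) / (d * (1 + a))) + ereal e"
          by simp
      qed
    qed
  qed
qed

end

text \<open>The converse half of (a) assumes \<open>deg + q\<close> nonzero on \<open>V\<close>: a
  nonempty edgeless graph with \<open>q = 0\<close> is \<open>(a, 0)\<close>-sparse, yet its Cheeger
  constant is 0 by the convention for the quotient.\<close>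

theorem theorem5p4:
  fixes V :: "'a set" and E :: "'a \<Rightarrow> 'a \<Rightarrow> bool" and q :: "'a \<Rightarrow> real" and a k :: real
  assumes "locally_finite_graph V E"
    and "a \<ge> 0" and "k \<ge> 0"
    and "\<And>x. x \<in> V \<Longrightarrow> q x \<ge> 0"
  shows "((cheeger_const V E q \<ge> ereal (1 / (1 + a)) \<longrightarrow> sparse V E q a 0) \<and>
          ((\<forall>x\<in>V. deg V E x + q x \<noteq> 0) \<longrightarrow>
             sparse V E q a 0 \<longrightarrow> cheeger_const V E q \<ge> ereal (1 / (1 + a)))) \<and>
         (sparse V E q a k \<longrightarrow>
            (let d = inf_deg_pot V E q in
               cheeger_const V E q \<ge> (d - ereal k) / (d * ereal (1 + a)) \<and>
               (d > ereal k \<longrightarrow> cheeger_const V E q > 0))) \<and>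
         (\<forall>d::real.
            sparse V E q a k \<and> (\<forall>k'<k. \<not> sparse V E q a k') \<and>
            (\<forall>x\<in>V. d = deg V E x + q x) \<longrightarrow>
            cheeger_const V E q = ereal ((d - k) / (d * (1 + a))))"
proof -
  interpret potential_graph V E q
    using assms by (simp add: potential_graph_def potential_graph_axioms_def)
  show ?thesis
    unfolding Let_def
  proof (intro conjI impI allI; (elim conjE)?)
    show "sparse V E q a 0" if "cheeger_const V E q \<ge> ereal (1 / (1 + a))"
      by (rule sparse_if_cheeger_const_ge[OF assms(2) that])
    show "cheeger_const V E q \<ge> ereal (1 / (1 + a))"
      if "\<forall>x\<in>V. deg V E x + q x \<noteq> 0" "sparse V E q a 0"
      using that by (intro cheeger_const_ge_if_sparse_0[OF assms(2)]) auto
    show "cheeger_const V E q \<ge>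
        (inf_deg_pot V E q - ereal k) / (inf_deg_pot V E q * ereal (1 + a))"
      if "sparse V E q a k"
      by (rule cheeger_const_ge_inf_deg_pot(1)[OF assms(2,3) that])
    show "cheeger_const V E q > 0" if "sparse V E q a k" "inf_deg_pot V E q > ereal k"
      by (rule cheeger_const_ge_inf_deg_pot(2)[OF assms(2,3) that])
    show "cheeger_const V E q = ereal ((d - k) / (d * (1 + a)))"
      if "sparse V E q a k" "\<forall>k'<k. \<not> sparse V E q a k'" "\<forall>x\<in>V. d = deg V E x + q x" for d
      using that by (intro cheeger_const_eq[OF assms(2,3)]) auto
  qed
qed

end
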